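(* Let $\mathbb{F}$ be a perfect field of characteristic $p>0$ and let $P(X)\in\mathbb{F}_p(t)[X]$ be a nonzero additive polynomial. Let $\zeta\in\overline{\mathbb{F}}$. If $x\in\mathbb{F}((t^{\mathbb{Q}}))$ is a root of $P$ and $r\in\mathbb{Q}$ is such that $\zeta$ expands $x$ at $r$, then $r$ is a point of intersection of $P$.
   Context: $\overline{\mathbb{F}}$ is the algebraic closure of $\mathbb{F}$. For a field $K$, $K((t^{\mathbb{Q}}))$ is the Hahn field of generalised power series $x=\sum_{\gamma}a_\gamma t^\gamma$ with $a_\gamma\in K$ and well-ordered support $\{\gamma\in\mathbb{Q}\mid a_\gamma\neq0\}$; $v$ is the $t$-adic valuation (minimum of the support, $v(0)=\infty$), and $\mathbb{F}_p(t)\subseteq\mathbb{F}((t^{\mathbb{Q}}))$ in the natural way. For $r\in\mathbb{Q}$, $x_{<r}=\sum_{\gamma<r}a_\gamma t^\gamma$ and $x_{\le r}=\sum_{\gamma\le r}a_\gamma t^\gamma$. Additive polynomials: a polynomial $P$ over a field is additive if $P(X+Y)=P(X)+P(Y)$ as polynomials in $X$ and $Y$; in characteristic $p$ this means $P(X)=\sum_{i=0}^n a_iX^{p^i}$. Points of intersection: for $P(X)=\sum_{i=0}^n a_iX^{p^i}$ put $I_P=\{i\in\{0,\dots,n\}\mid a_i\neq 0\}$. For $i\in I_P$ let $\gamma_i(r)=p^ir+v(a_i)$ for $r\in\mathbb{R}$, and $\gamma_i(\infty)=\infty$. Let $J(r)=\{i\in I_P\mid \gamma_i(r)=\min_{j\in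 I_P}\gamma_j(r)\}$. An element $r\in\mathbb{R}\cup\{\infty\}$ is a point of intersection of $P$ if $|J(r)|>1$. Expansion: let $x\in\mathbb{F}((t^{\mathbb{Q}}))$ and $r\in\mathbb{Q}$, and suppose that $x_{\le r}-x_{<r}=\zeta t^r$ is nonzero. Let $K$ be the minimal subfield of $\mathbb{F}$ such that $x_{<r}\in K((t^{\mathbb{Q}}))$. Then $\zeta$ expands $x$ at $r$ if $\zeta\notin K$. *)

theory Defs
  imports
    "HOL-Algebra.Algebraic_Closure_Type"
    "HOL-Computational_Algebra.Polynomial"
    "HOL-Library.Extended_Real"
begin

hide_const (open) UnivPoly.coeff UnivPoly.monom

section \<open>Well-ordered sets of rational numbers\<close>

lemma wfp_on_min_iff:
  "wfp_on A ((<) :: 'a::linorder \<Rightarrow> _) \<longleftrightarrow>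
    (\<forall>B\<subseteq>A. B \<noteq> {} \<longrightarrow> (\<exists>m\<in>B. \<forall>b\<in>B. m \<le> b))"
proof -
  have "(\<forall>y. y < z \<longrightarrow> y \<notin> B) \<longleftrightarrow> (\<forall>b\<in>B. z \<le> b)" for z :: 'a and B
    by (metis not_le)
  then show ?thesis unfolding wfp_on_iff_ex_minimal by simp
qed

lemma wfp_on_minE:
  assumes "wfp_on A ((<) :: 'a::linorder \<Rightarrow> _)" "B \<subseteq> A" "B \<noteq> {}"
  obtains m where "m \<in> B" "\<And>b. b \<in> B \<Longrightarrow> m \<le> b"
proof -
  have "\<exists>m\<in>B. \<forall>b\<in>B. m \<le> b"
    using assms(1)[unfolded wfp_on_min_iff, rule_format, OF assms(2,3)] .
  then show ?thesis using that by blast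
qed

lemma wfp_on_rat_subset:
  "wfp_on A ((<) :: 'a::linorder \<Rightarrow> _) \<Longrightarrow> B \<subseteq> A \<Longrightarrow> wfp_on B (<)"
  by (meson subset_trans wfp_on_min_iff)

lemma wfp_on_rat_Un:
  assumes "wfp_on A ((<) :: 'a::linorder \<Rightarrow> _)" "wfp_on B (<)"
  shows "wfp_on (A \<union> B) (<)"
  unfolding wfp_on_min_iff
proof (intro allI impI)
  fix C assume C: "C \<subseteq> A \<union> B" "C \<noteq> {}"
  show "\<exists>m\<in>C. \<forall>b\<in>C. m \<le> b"
  proof (cases "C \<inter> A = {} \<or> C \<inter> B = {}")
    case True
    then have "C \<subseteq> A \<or> C \<subseteq> B" using C by blast
    then show ?thesis using wfp_on_minE[OF assms(1) _ C(2)] wfp_on_minE[OF assms(2) _ C(2)] by metis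
  next
    case False
    obtain m where m: "m \<in> C \<inter> A" "\<And>b. b \<in> C \<inter> A \<Longrightarrow> m \<le> b"
      using wfp_on_minE[OF assms(1), of "C \<inter> A"] False by blast
    obtain n where n: "n \<in> C \<inter> B" "\<And>b. b \<in> C \<inter> B \<Longrightarrow> n \<le> b"
      using wfp_on_minE[OF assms(2), of "C \<inter> B"] False by blast
    have "\<forall>b\<in>C. min m n \<le> b" using m n C(1) by (auto simp: min_le_iff_disj)
    moreover have "min m n \<in> C" using m n by (simp add: min_def)
    ultimately show ?thesis by blast
  qed
qed

lemma finite_wfp_on_both:
  assumes lo: "wfp_on A ((<) :: 'a::linorder \<Rightarrow> _)"
    and hi: "\<And>B. B \<subseteq> A \<Longrightarrow> B \<noteq> {} \<Longrightarrow> \<exists>m\<in>B. \<forall>b\<in>B. b \<le> m"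
  shows "finite A"
proof (cases "A = {}")
  case False
  define T where "T = {s\<in>A. finite {x\<in>A. x \<le> s}}"
  obtain a where a: "a \<in> A" "\<And>b. b \<in> A \<Longrightarrow> a \<le> b"
    using wfp_on_minE[OF lo, of A] False by blast
  have "{x\<in>A. x \<le> a} \<subseteq> {a}" using a by force
  then have "a \<in> T" using a finite_subset unfolding T_def by blast
  then obtain m where m: "m \<in> T" "\<And>b. b \<in> T \<Longrightarrow> b \<le> m"
    using hi[of T] unfolding T_def by blast
  have "{x\<in>A. m < x} = {}"
  proof (rule ccontr)
    assume ne: "{x\<in>A. m < x} \<noteq> {}"
    obtain n where n: "n \<in> {x\<in>A. m < x}" "\<And>b. b \<in> {x\<in>A. m < x} \<Longrightarrow> n \<le> b"
      using wfp_on_minE[OF lo _ ne] by blast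
    have "{x\<in>A. x \<le> n} \<subseteq> insert n {x\<in>A. x \<le> m}" using n(2) by force
    moreover have "finite (insert n {x\<in>A. x \<le> m})" using m(1) unfolding T_def by simp
    ultimately have "finite {x\<in>A. x \<le> n}" by (rule finite_subset)
    then have "n \<in> T" using n(1) unfolding T_def by simp
    then show False using m(2) n(1) by force
  qed
  then have "A \<subseteq> {x\<in>A. x \<le> m}" by force
  then show ?thesis using m(1) finite_subset unfolding T_def by blast
qed simp

lemma finite_antidiagonal:
  fixes A B :: "rat set"
  assumes "wfp_on A (<)" "wfp_on B (<)"
  shows "finite {a\<in>A. c - a \<in> B}"
proof (rule finite_wfp_on_both)
  show "wfp_on {a \<in> A. c - a \<in> B} (<)" using assms(1) by (rule wfp_on_rat_subset) auto
next
  fix S assume S: "S \<subseteq> {a \<in> A. c - a \<in> B}" "S \<noteq> {}"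
  obtain m where m: "m \<in> (\<lambda>a. c - a) ` S" "\<And>b. b \<in> (\<lambda>a. c - a) ` S \<Longrightarrow> m \<le> b"
    using wfp_on_minE[OF assms(2), of "(\<lambda>a. c - a) ` S"] S by blast
  then show "\<exists>m\<in>S. \<forall>b\<in>S. b \<le> m" by force
qed

lemma wfp_on_incseq:
  fixes s :: "nat \<Rightarrow> rat"
  assumes "wfp_on A (<)" "range s \<subseteq> A"
  shows "\<exists>f. strict_mono f \<and> incseq (\<lambda>n. s (f n))"
proof -
  obtain f where f: "strict_mono f" "monoseq (\<lambda>n. s (f n))"
    using seq_monosub[of s] by blast
  consider "incseq (\<lambda>n. s (f n))" | "decseq (\<lambda>n. s (f n))"
    using f(2) unfolding monoseq_iff by blast
  then show ?thesis
  proof cases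
    case 1
    with f show ?thesis by blast
  next
    case 2
    obtain m where m: "m \<in> range (\<lambda>n. s (f n))" "\<And>b. b \<in> range (\<lambda>n. s (f n)) \<Longrightarrow> m \<le> b"
      using wfp_on_minE[OF assms(1), of "range (\<lambda>n. s (f n))"] assms(2) by blast
    then obtain N where N: "m = s (f N)" by blast
    have "s (f (n + N)) = m" for n
      using m(2)[of "s (f (n + N))"] 2 N unfolding decseq_def
      by (intro antisym) auto
    then have "incseq (\<lambda>n. s (f (n + N)))" by (simp add: incseq_def)
    moreover have "strict_mono (\<lambda>n. f (n + N))" using f(1) by (simp add: strict_mono_def)
    ultimately show ?thesis by (intro exI[of _ "\<lambda>n. f (n + N)"] conjI) auto
  qed
qed

lemma wfp_on_no_strict_decseq:
  fixes s :: "nat \<Rightarrow> rat"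
  assumes "wfp_on A (<)" "range s \<subseteq> A" "\<And>n. s (Suc n) < s n"
  shows False
proof -
  obtain m where m: "m \<in> range s" "\<And>b. b \<in> range s \<Longrightarrow> m \<le> b"
    using wfp_on_minE[OF assms(1,2)] by blast
  then obtain N where "m = s N" by blast
  with m(2)[of "s (Suc N)"] assms(3)[of N] show False by simp
qed

lemma wfp_on_set_sum:
  fixes A B :: "rat set"
  assumes A: "wfp_on A (<)" and B: "wfp_on B (<)"
  shows "wfp_on {a + b |a b. a \<in> A \<and> b \<in> B} (<)"
  unfolding wfp_on_min_iff
proof (intro allI impI, rule ccontr)
  fix C assume C: "C \<subseteq> {a + b |a b. a \<in> A \<and> b \<in> B}" "C \<noteq> {}"
    and no: "\<not> (\<exists>m\<in>C. \<forall>b\<in>C. m \<le> b)"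
  obtain c0 where "c0 \<in> C" using C by blast
  then obtain c :: "nat \<Rightarrow> rat" where c: "\<And>n. c n \<in> C" "\<And>n. c (Suc n) < c n"
  proof -
    have "\<exists>y. y \<in> C \<and> y < x" if "x \<in> C" for x using no that by (meson not_le)
    then show ?thesis
      using that dependent_nat_choice[of "\<lambda>_ x. x \<in> C" "\<lambda>_ x y. y < x"] \<open>c0 \<in> C\<close> by blast
  qed
  have "\<forall>n. \<exists>a b. c n = a + b \<and> a \<in> A \<and> b \<in> B" using c(1) C(1) by blast
  then obtain a b where ab: "\<And>n. c n = a n + b n" "\<And>n. a n \<in> A" "\<And>n. b n \<in> B" by metis
  obtain f where f: "strict_mono f" "incseq (\<lambda>n. a (f n))"
    using wfp_on_incseq[OF A, of a] ab(2) by blast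
  have dec: "c m < c n" if "n < m" for n m
    using lift_Suc_mono_less[of "\<lambda>n. - c n" n m] c(2) that by simp
  have "b (f (Suc n)) < b (f n)" for n
  proof -
    have "c (f (Suc n)) < c (f n)" using f(1) by (intro dec) (simp add: strict_mono_def)
    moreover have "a (f n) \<le> a (f (Suc n))" using incseq_SucD[OF f(2), of n] by simp
    ultimately show ?thesis using ab(1)[of "f n"] ab(1)[of "f (Suc n)"] by linarith
  qed
  then show False using wfp_on_no_strict_decseq[OF B, of "\<lambda>n. b (f n)"] ab(3) by blast
qed

section \<open>The Hahn field of generalised power series with rational exponents\<close>

typedef (overloaded) 'a::zero hahn =
    "{f :: rat \<Rightarrow> 'a. wfp_on {\<gamma>. f \<gamma> \<noteq> 0} (<)}"
  morphisms hahn_coeff Abs_hahn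
  by (rule exI[of _ "\<lambda>_. 0"]) (auto simp: wfp_on_min_iff)

setup_lifting type_definition_hahn

definition hahn_supp :: "'a::zero hahn \<Rightarrow> rat set" where
  "hahn_supp x = {\<gamma>. hahn_coeff x \<gamma> \<noteq> 0}"

lemma wfp_on_hahn_supp: "wfp_on (hahn_supp x) (<)"
  unfolding hahn_supp_def using hahn_coeff[of x] by simp

lemma hahn_eqI: "(\<And>\<gamma>. hahn_coeff x \<gamma> = hahn_coeff y \<gamma>) \<Longrightarrow> x = y"
  by transfer auto

lift_definition hahn_monom :: "'a::zero \<Rightarrow> rat \<Rightarrow> 'a hahn" is
  "\<lambda>c r \<gamma>. if \<gamma> = r then c else 0"
  by (auto simp: wfp_on_min_iff)

instantiation hahn :: (zero) zero
begin
lift_definition zero_hahn :: "'a hahn" is "\<lambda>_. 0"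
  by (auto simp: wfp_on_min_iff)
instance ..
end

instantiation hahn :: (comm_ring_1) comm_ring_1
begin

definition one_hahn :: "'a hahn" where "1 = hahn_monom 1 0"

lift_definition plus_hahn :: "'a hahn \<Rightarrow> 'a hahn \<Rightarrow> 'a hahn" is "\<lambda>x y \<gamma>. x \<gamma> + y \<gamma>"
proof -
  fix f g :: "rat \<Rightarrow> 'a"
  assume "wfp_on {\<gamma>. f \<gamma> \<noteq> 0} (<)" "wfp_on {\<gamma>. g \<gamma> \<noteq> 0} (<)"
  from wfp_on_rat_Un[OF this] show "wfp_on {\<gamma>. f \<gamma> + g \<gamma> \<noteq> 0} (<)"
    by (rule wfp_on_rat_subset) auto
qed

lift_definition uminus_hahn :: "'a hahn \<Rightarrow> 'a hahn" is "\<lambda>x \<gamma>. - x \<gamma>"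
  by simp

definition minus_hahn :: "'a hahn \<Rightarrow> 'a hahn \<Rightarrow> 'a hahn" where "minus_hahn x y = x + (- y)"

text \<open>The sum below ranges over a finite set (\<open>finite_antidiagonal\<close>), so this is the usual
  Cauchy product.\<close>

lift_definition times_hahn :: "'a hahn \<Rightarrow> 'a hahn \<Rightarrow> 'a hahn" is
  "\<lambda>x y \<gamma>. \<Sum>\<alpha> \<in> {\<alpha>. x \<alpha> \<noteq> 0 \<and> y (\<gamma> - \<alpha>) \<noteq> 0}. x \<alpha> * y (\<gamma> - \<alpha>)"
proof -
  fix f g :: "rat \<Rightarrow> 'a"
  assume "wfp_on {\<gamma>. f \<gamma> \<noteq> 0} (<)" "wfp_on {\<gamma>. g \<gamma> \<noteq> 0} (<)"
  from wfp_on_set_sum[OF this]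
  show "wfp_on {\<gamma>. (\<Sum>\<alpha> \<in> {\<alpha>. f \<alpha> \<noteq> 0 \<and> g (\<gamma> - \<alpha>) \<noteq> 0}. f \<alpha> * g (\<gamma> - \<alpha>)) \<noteq> 0} (<)"
  proof (rule wfp_on_rat_subset, intro subsetI)
    fix \<gamma> assume "\<gamma> \<in> {\<gamma>. (\<Sum>\<alpha> \<in> {\<alpha>. f \<alpha> \<noteq> 0 \<and> g (\<gamma> - \<alpha>) \<noteq> 0}. f \<alpha> * g (\<gamma> - \<alpha>)) \<noteq> 0}"
    then obtain \<alpha> where "f \<alpha> \<noteq> 0" "g (\<gamma> - \<alpha>) \<noteq> 0"
      unfolding mem_Collect_eq by (rule sum.not_neutral_contains_not_neutral) blast
    then show "\<gamma> \<in> {a + b |a b. a \<in> {\<gamma>. f \<gamma> \<noteq> 0} \<and> b \<in> {\<gamma>. g \<gamma> \<noteq> 0}}"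
      by (intro CollectI exI[of _ \<alpha>] exI[of _ "\<gamma> - \<alpha>"]) simp
  qed
qed

lemma hahn_coeff_times:
  "hahn_coeff (x * y :: 'a hahn) \<gamma> =
    (\<Sum>\<alpha> \<in> {\<alpha>\<in>hahn_supp x. \<gamma> - \<alpha> \<in> hahn_supp y}. hahn_coeff x \<alpha> * hahn_coeff y (\<gamma> - \<alpha>))"
  unfolding hahn_supp_def by transfer simp

lemma hahn_coeff_times_superset:
  assumes "finite S" "{\<alpha>\<in>hahn_supp x. \<gamma> - \<alpha> \<in> hahn_supp y} \<subseteq> S"
  shows "hahn_coeff (x * y :: 'a hahn) \<gamma> = (\<Sum>\<alpha>\<in>S. hahn_coeff x \<alpha> * hahn_coeff y (\<gamma> - \<alpha>))"
  unfolding hahn_coeff_times using assms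
  by (intro sum.mono_neutral_left) (auto simp: hahn_supp_def)

lemma hahn_supp_times:
  "hahn_supp (x * y :: 'a hahn) \<subseteq> {a + b |a b. a \<in> hahn_supp x \<and> b \<in> hahn_supp y}"
proof
  fix \<gamma> assume "\<gamma> \<in> hahn_supp (x * y)"
  then have "hahn_coeff (x * y) \<gamma> \<noteq> 0" by (simp add: hahn_supp_def)
  then obtain \<alpha> where "\<alpha> \<in> hahn_supp x" "\<gamma> - \<alpha> \<in> hahn_supp y"
    unfolding hahn_coeff_times by (rule sum.not_neutral_contains_not_neutral) blast
  then show "\<gamma> \<in> {a + b |a b. a \<in> hahn_supp x \<and> b \<in> hahn_supp y}"
    by (intro CollectI exI[of _ \<alpha>] exI[of _ "\<gamma> - \<alpha>"]) simp
qed

lemma hahn_times_commute: "x * y = y * (x :: 'a hahn)"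
proof (rule hahn_eqI)
  fix \<gamma>
  show "hahn_coeff (x * y) \<gamma> = hahn_coeff (y * x) \<gamma>"
    unfolding hahn_coeff_times
    by (rule sum.reindex_bij_witness[of _ "\<lambda>a. \<gamma> - a" "\<lambda>a. \<gamma> - a"]) (auto simp: mult.commute)
qed

lemma hahn_coeff_times3:
  "hahn_coeff (x * (y * z) :: 'a hahn) \<gamma> =
    (\<Sum>(a,b) \<in> {(a,b). a \<in> hahn_supp x \<and> b \<in> hahn_supp y \<and> \<gamma> - a - b \<in> hahn_supp z}.
      hahn_coeff x a * hahn_coeff y b * hahn_coeff z (\<gamma> - a - b))"
proof -
  define S where
    "S = {a\<in>hahn_supp x. \<gamma> - a \<in> {b + c |b c. b \<in> hahn_supp y \<and> c \<in> hahn_supp z}}"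
  define T where "T = (\<lambda>a. {b\<in>hahn_supp y. (\<gamma> - a) - b \<in> hahn_supp z})"
  have finS: "finite S"
    unfolding S_def
    by (intro finite_antidiagonal wfp_on_set_sum wfp_on_hahn_supp)
  have finT: "finite (T a)" for a
    unfolding T_def by (intro finite_antidiagonal wfp_on_hahn_supp)
  have "hahn_coeff (x * (y * z)) \<gamma> = (\<Sum>a\<in>S. hahn_coeff x a * hahn_coeff (y * z) (\<gamma> - a))"
    using hahn_supp_times[of y z] by (intro hahn_coeff_times_superset finS) (auto simp: S_def)
  also have "\<dots> = (\<Sum>a\<in>S. \<Sum>b\<in>T a. hahn_coeff x a * hahn_coeff y b * hahn_coeff z (\<gamma> - a - b))"
    by (simp add: hahn_coeff_times T_def sum_distrib_left mult.assoc)
  also have "\<dots> = (\<Sum>(a,b)\<in>Sigma S T. hahn_coeff x a * hahn_coeff y b * hahn_coeff z (\<gamma> - a - b))"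
    using finS finT by (intro sum.Sigma) auto
  also have "Sigma S T = {(a,b). a \<in> hahn_supp x \<and> b \<in> hahn_supp y \<and> \<gamma> - a - b \<in> hahn_supp z}"
  proof -
    have "a \<in> S" if "a \<in> hahn_supp x" "b \<in> hahn_supp y" "\<gamma> - a - b \<in> hahn_supp z" for a b
    proof -
      have "\<gamma> - a = b + (\<gamma> - a - b)" by simp
      with that show ?thesis unfolding S_def by blast
    qed
    then show ?thesis unfolding T_def by (auto simp: S_def)
  qed
  finally show ?thesis .
qed

lemma hahn_times_assoc: "x * y * z = x * (y * z :: 'a hahn)"
proof (rule hahn_eqI)
  fix \<gamma>
  have "hahn_coeff (x * y * z) \<gamma> = hahn_coeff (z * (x * y)) \<gamma>"
    by (simp only: hahn_times_commute[of "x * y" z])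
  also have "\<dots> = hahn_coeff (x * (y * z)) \<gamma>"
    unfolding hahn_coeff_times3
    by (rule sum.reindex_bij_witness[of _ "\<lambda>(a,b). (\<gamma> - a - b, a)" "\<lambda>(a,b). (b, \<gamma> - a - b)"])
       (auto simp: algebra_simps)
  finally show "hahn_coeff (x * y * z) \<gamma> = hahn_coeff (x * (y * z)) \<gamma>" .
qed

lemma hahn_coeff_monom_times:
  "hahn_coeff (hahn_monom c r * x :: 'a hahn) \<gamma> = c * hahn_coeff x (\<gamma> - r)"
proof -
  have "hahn_coeff (hahn_monom c r * x) \<gamma> =
      (\<Sum>\<alpha>\<in>{r}. hahn_coeff (hahn_monom c r) \<alpha> * hahn_coeff x (\<gamma> - \<alpha>))"
    by (intro hahn_coeff_times_superset)
       (auto simp: hahn_supp_def hahn_monom.rep_eq split: if_splits)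
  then show ?thesis by (simp add: hahn_monom.rep_eq)
qed

instance
proof
  fix x y z :: "'a hahn"
  show "x * y * z = x * (y * z)" by (rule hahn_times_assoc)
  show "x * y = y * x" by (rule hahn_times_commute)
  show "1 * x = x"
    by (rule hahn_eqI) (simp add: one_hahn_def hahn_coeff_monom_times)
  show "(x + y) * z = x * z + y * z"
  proof (rule hahn_eqI)
    fix \<gamma>
    define S where "S = {\<alpha>\<in>hahn_supp x \<union> hahn_supp y. \<gamma> - \<alpha> \<in> hahn_supp z}"
    have fin: "finite S"
      unfolding S_def by (intro finite_antidiagonal wfp_on_rat_Un wfp_on_hahn_supp)
    have "hahn_coeff (w * z) \<gamma> = (\<Sum>\<alpha>\<in>S. hahn_coeff w \<alpha> * hahn_coeff z (\<gamma> - \<alpha>))"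
      if "hahn_supp w \<subseteq> hahn_supp x \<union> hahn_supp y" for w
      using that fin by (intro hahn_coeff_times_superset) (auto simp: S_def)
    moreover have "hahn_supp (x + y) \<subseteq> hahn_supp x \<union> hahn_supp y"
      by (auto simp: hahn_supp_def plus_hahn.rep_eq)
    ultimately show "hahn_coeff ((x + y) * z) \<gamma> = hahn_coeff (x * z + y * z) \<gamma>"
      by (simp add: plus_hahn.rep_eq sum.distrib[symmetric] distrib_right)
  qed
  show "(0 :: 'a hahn) \<noteq> 1"
    unfolding one_hahn_def by transfer (metis zero_neq_one)
  show "x + y + z = x + (y + z)" by transfer (simp add: add.assoc)
  show "x + y = y + x" by transfer (simp add: add.commute)
  show "0 + x = x" by transfer simp
  show "- x + x = 0" by transfer simp
  show "x - y = x + - y" by (rule minus_hahn_def)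
qed

end

lemma hahn_coeff_zero [simp]: "hahn_coeff 0 \<gamma> = 0"
  by transfer simp

lemma hahn_coeff_add [simp]:
  "hahn_coeff (x + y :: 'a::comm_ring_1 hahn) \<gamma> = hahn_coeff x \<gamma> + hahn_coeff y \<gamma>"
  by transfer simp

lemma hahn_coeff_uminus [simp]:
  "hahn_coeff (- x :: 'a::comm_ring_1 hahn) \<gamma> = - hahn_coeff x \<gamma>"
  by transfer simp

lemma hahn_coeff_diff [simp]:
  "hahn_coeff (x - y :: 'a::comm_ring_1 hahn) \<gamma> = hahn_coeff x \<gamma> - hahn_coeff y \<gamma>"
  by (simp only: minus_hahn_def hahn_coeff_add hahn_coeff_uminus) simp

lemma hahn_coeff_monom: "hahn_coeff (hahn_monom c r) \<gamma> = (if \<gamma> = r then c else 0)"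
  by transfer simp

lemma hahn_coeff_one: "hahn_coeff (1 :: 'a::comm_ring_1 hahn) \<gamma> = (if \<gamma> = 0 then 1 else 0)"
  by (simp add: one_hahn_def hahn_coeff_monom)

lemma hahn_coeff_sum:
  "hahn_coeff (\<Sum>i\<in>I. f i :: 'a::comm_ring_1 hahn) \<gamma> = (\<Sum>i\<in>I. hahn_coeff (f i) \<gamma>)"
  by (induction I rule: infinite_finite_induct) auto

lemma hahn_supp_power_ge:
  fixes u :: "'a::comm_ring_1 hahn"
  assumes "\<And>\<alpha>. \<alpha> \<in> hahn_supp u \<Longrightarrow> s \<le> \<alpha>" "\<gamma> \<in> hahn_supp (u ^ n)"
  shows "of_nat n * s \<le> \<gamma>"
  using assms(2)
proof (induction n arbitrary: \<gamma>)
  case 0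
  then show ?case by (auto simp: hahn_supp_def hahn_coeff_one split: if_splits)
next
  case (Suc n)
  then have "\<gamma> \<in> hahn_supp (u * u ^ n)" by simp
  then obtain a b where "\<gamma> = a + b" "a \<in> hahn_supp u" "b \<in> hahn_supp (u ^ n)"
    using hahn_supp_times[of u "u ^ n"] by blast
  with Suc.IH[of b] assms(1)[of a] show ?case by (simp add: algebra_simps)
qed

lemma hahn_coeff_times_cong:
  fixes x :: "'a::comm_ring_1 hahn"
  assumes "\<And>\<alpha>. \<alpha> \<in> hahn_supp x \<Longrightarrow> 0 \<le> \<alpha>"
    and "\<And>\<beta>. \<beta> \<le> \<gamma> \<Longrightarrow> hahn_coeff y \<beta> = hahn_coeff w \<beta>"
  shows "hahn_coeff (x * y) \<gamma> = hahn_coeff (x * w) \<gamma>"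
  unfolding hahn_coeff_times
  by (rule sum.cong) (use assms in \<open>auto simp: hahn_supp_def\<close>)

lemma hahn_one_minus_unit:
  fixes u :: "'a::comm_ring_1 hahn"
  assumes pos: "\<And>\<alpha>. \<alpha> \<in> hahn_supp u \<Longrightarrow> 0 < \<alpha>"
  shows "\<exists>y. (1 - u) * y = 1"
proof (cases "hahn_supp u = {}")
  case True
  then have "u = 0" by (intro hahn_eqI) (auto simp: hahn_supp_def)
  then show ?thesis by auto
next
  case False
  obtain s where s: "s \<in> hahn_supp u" "\<And>b. b \<in> hahn_supp u \<Longrightarrow> s \<le> b"
    using wfp_on_minE[OF wfp_on_hahn_supp subset_refl False] by blast
  have s0: "0 < s" using pos s(1) .
  have vanish: "hahn_coeff (u ^ n) \<gamma> = 0" if "\<gamma> < of_nat n * s" for n \<gamma>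
    using hahn_supp_power_ge[of u s \<gamma> n] s(2) that by (auto simp: hahn_supp_def)
  define w where "w = (\<lambda>M. \<Sum>n\<le>M. u ^ n)"
  have "\<exists>M::nat. \<gamma> \<le> of_nat M * s" for \<gamma>
    using real_arch_simple[of "\<gamma> / s"] s0 by (auto simp: field_simps)
  then obtain N :: "rat \<Rightarrow> nat" where N: "\<And>\<gamma>. \<gamma> \<le> of_nat (N \<gamma>) * s" by metis
  have stable: "hahn_coeff (w (M + k)) \<gamma> = hahn_coeff (w M) \<gamma>" if "\<gamma> \<le> of_nat M * s" for M k \<gamma>
  proof (induction k)
    case (Suc k)
    have "of_nat M * s < of_nat (Suc (M + k)) * s" using s0 by simp
    then have "hahn_coeff (u ^ Suc (M + k)) \<gamma> = 0" using that vanish by (meson le_less_trans)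
    then show ?case using Suc by (simp add: w_def)
  qed simp
  have stable': "hahn_coeff (w M) \<gamma> = hahn_coeff (w M') \<gamma>"
    if "\<gamma> \<le> of_nat M * s" "\<gamma> \<le> of_nat M' * s" for M M' \<gamma>
    using stable[OF that(1), of "M' - M"] stable[OF that(2), of "M - M'"]
    by (cases "M \<le> M'") auto
  define f where "f = (\<lambda>\<gamma>. hahn_coeff (w (N \<gamma>)) \<gamma>)"
  have f: "f \<beta> = hahn_coeff (w (N \<gamma>)) \<beta>" if "\<beta> \<le> \<gamma>" for \<beta> \<gamma>
    unfolding f_def using that N[of \<beta>] N[of \<gamma>] by (intro stable') auto
  have "wfp_on {\<gamma>. f \<gamma> \<noteq> 0} (<)"
    unfolding wfp_on_min_iff
  proof (intro allI impI)
    fix B assume B: "B \<subseteq> {\<gamma>. f \<gamma> \<noteq> 0}" "B \<noteq> {}"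
    then obtain c where c: "c \<in> B" by blast
    have "{b\<in>B. b \<le> c} \<subseteq> hahn_supp (w (N c))"
      using B(1) f by (auto simp: hahn_supp_def)
    moreover have "{b\<in>B. b \<le> c} \<noteq> {}" using c by blast
    ultimately obtain m where "m \<in> {b\<in>B. b \<le> c}" "\<And>b. b \<in> {b\<in>B. b \<le> c} \<Longrightarrow> m \<le> b"
      using wfp_on_minE[OF wfp_on_hahn_supp] by blast
    then have "m \<in> B \<and> (\<forall>b\<in>B. m \<le> b)" by force
    then show "\<exists>m\<in>B. \<forall>b\<in>B. m \<le> b" by blast
  qed
  then have coeff_y: "hahn_coeff (Abs_hahn f) = f" by (simp add: Abs_hahn_inverse)
  have "(1 - u) * Abs_hahn f = 1"
  proof (rule hahn_eqI)
    fix \<gamma>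
    have "hahn_coeff ((1 - u) * Abs_hahn f) \<gamma> = hahn_coeff ((1 - u) * w (N \<gamma>)) \<gamma>"
    proof (rule hahn_coeff_times_cong)
      fix \<alpha> assume "\<alpha> \<in> hahn_supp (1 - u)"
      then have "\<alpha> = 0 \<or> \<alpha> \<in> hahn_supp u"
        by (auto simp: hahn_supp_def hahn_coeff_one split: if_splits)
      then show "0 \<le> \<alpha>" using pos by force
    qed (simp add: coeff_y f)
    also have "(1 - u) * w (N \<gamma>) = 1 - u ^ Suc (N \<gamma>)"
      unfolding w_def by (rule sum_gp_basic)
    also have "hahn_coeff (u ^ Suc (N \<gamma>)) \<gamma> = 0"
    proof (rule vanish)
      have "of_nat (N \<gamma>) * s < of_nat (Suc (N \<gamma>)) * s" using s0 by simp
      then show "\<gamma> < of_nat (Suc (N \<gamma>)) * s" using N[of \<gamma>] by (rule le_less_trans[rotated])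
    qed
    then have "hahn_coeff (1 - u ^ Suc (N \<gamma>)) \<gamma> = hahn_coeff 1 \<gamma>" by simp
    finally show "hahn_coeff ((1 - u) * Abs_hahn f) \<gamma> = hahn_coeff 1 \<gamma>" .
  qed
  then show ?thesis by blast
qed

lemma hahn_unit:
  fixes x :: "'a::field hahn"
  assumes "x \<noteq> 0"
  shows "\<exists>y. x * y = 1"
proof -
  have "hahn_supp x \<noteq> {}"
    using assms by (metis (mono_tags) Collect_empty_eq hahn_coeff_zero hahn_eqI hahn_supp_def)
  then obtain m where m: "m \<in> hahn_supp x" "\<And>b. b \<in> hahn_supp x \<Longrightarrow> m \<le> b"
    using wfp_on_minE[OF wfp_on_hahn_supp subset_refl] by blast
  define c where "c = hahn_coeff x m"
  have c: "c \<noteq> 0" using m(1) by (simp add: c_def hahn_supp_def)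
  define u where "u = 1 - hahn_monom (inverse c) (- m) * x"
  have "\<exists>y. (1 - u) * y = 1"
  proof (rule hahn_one_minus_unit)
    fix \<alpha> assume "\<alpha> \<in> hahn_supp u"
    then have "hahn_coeff u \<alpha> \<noteq> 0" by (simp add: hahn_supp_def)
    then have ne: "(if \<alpha> = 0 then 1 else 0) - inverse c * hahn_coeff x (\<alpha> + m) \<noteq> 0"
      by (simp add: u_def hahn_coeff_one hahn_coeff_monom_times)
    then have "\<alpha> \<noteq> 0" using c by (auto simp: c_def)
    moreover have "\<alpha> + m \<in> hahn_supp x" using ne \<open>\<alpha> \<noteq> 0\<close> by (auto simp: hahn_supp_def)
    ultimately show "0 < \<alpha>" using m(2)[of "\<alpha> + m"] by simp
  qed
  then obtain y where "hahn_monom (inverse c) (- m) * x * y = 1" by (auto simp: u_def)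
  then have "x * (hahn_monom (inverse c) (- m) * y) = 1" by (simp add: ac_simps)
  then show ?thesis by blast
qed

instantiation hahn :: (field) field
begin

definition inverse_hahn :: "'a hahn \<Rightarrow> 'a hahn" where
  "inverse_hahn x = (if x = 0 then 0 else THE y. x * y = 1)"

definition divide_hahn :: "'a hahn \<Rightarrow> 'a hahn \<Rightarrow> 'a hahn" where
  "divide_hahn x y = x * inverse y"

instance
proof
  fix x y :: "'a hahn"
  show "inverse x * x = 1" if "x \<noteq> 0"
  proof -
    have "\<exists>!y. x * y = 1"
    proof (rule ex_ex1I)
      show "\<exists>y. x * y = 1" by (rule hahn_unit[OF that])
    next
      fix y z assume "x * y = 1" "x * z = 1"
      then have "y = y * (x * z)" "z = (x * y) * z" by simp_all
      then show "y = z" by (simp add: ac_simps)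
    qed
    from theI'[OF this] show ?thesis using that by (simp add: inverse_hahn_def mult.commute)
  qed
  show "x div y = x * inverse y" by (rule divide_hahn_def)
  show "inverse (0 :: 'a hahn) = 0" by (simp add: inverse_hahn_def)
qed

end

definition hahn_val :: "'a::zero hahn \<Rightarrow> ereal" where
  "hahn_val x = (if x = 0 then \<infinity>
     else ereal (of_rat (LEAST \<gamma>. hahn_coeff x \<gamma> \<noteq> 0)))"

lift_definition hahn_trunc_less :: "'a::zero hahn \<Rightarrow> rat \<Rightarrow> 'a hahn" is
  "\<lambda>x r \<gamma>. if \<gamma> < r then x \<gamma> else 0"
  by (erule wfp_on_rat_subset) auto

lift_definition hahn_trunc_le :: "'a::zero hahn \<Rightarrow> rat \<Rightarrow> 'a hahn" is
  "\<lambda>x r \<gamma>. if \<gamma> \<le> r then x \<gamma> else 0"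
  by (erule wfp_on_rat_subset) auto

text \<open>The inclusion of the Hahn field over a field into the one over its algebraic closure.\<close>

lift_definition hahn_to_ac :: "'a::field hahn \<Rightarrow> 'a alg_closure hahn" is
  "\<lambda>x \<gamma>. to_ac (x \<gamma>)"
  by simp

text \<open>For a subfield \<open>K\<close> of the coefficient field, this is the subset \<open>K((t^\<rat>))\<close>.\<close>

definition hahn_over :: "'a::zero set \<Rightarrow> 'a hahn set" where
  "hahn_over K = {x. \<forall>\<gamma>. hahn_coeff x \<gamma> \<in> K}"

text \<open>In characteristic \<open>p > 0\<close>, the set \<open>\<int> = range of_int\<close> is the prime field, so \<open>f\<close> and
  \<open>g\<close> below range over \<open>\<bbbF>\<^sub>p[X]\<close> and this is the image of \<open>\<bbbF>\<^sub>p(t)\<close> in the Hahn field.\<close>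

definition prime_rational_functions :: "'a::field hahn set" where
  "prime_rational_functions =
     {poly f (hahn_monom 1 1) / poly g (hahn_monom 1 1) | f g.
        (\<forall>i. coeff f i \<in> \<int>) \<and> (\<forall>i. coeff g i \<in> \<int>) \<and> g \<noteq> 0}"

section \<open>Additive polynomials and points of intersection\<close>

definition perfect_field :: "'a::field itself \<Rightarrow> bool" where
  "perfect_field _ \<longleftrightarrow> CHAR('a) = 0 \<or> (\<forall>a::'a. \<exists>b. b ^ CHAR('a) = a)"

text \<open>The identity \<open>P(X + Y) = P(X) + P(Y)\<close> is stated in \<open>k[X][Y]\<close>, the type of polynomials
  in \<open>Y\<close> with coefficients in \<open>k[X]\<close>: there \<open>Y\<close> is \<open>[:0, 1:]\<close> and \<open>X\<close> is \<open>[:[:0, 1:]:]\<close>.\<close>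

definition additive_poly :: "'a::comm_ring_1 poly \<Rightarrow> bool" where
  "additive_poly P \<longleftrightarrow>
    (let Q = map_poly (\<lambda>c. [:[:c:]:]) P
     in poly Q ([:[:0, 1:]:] + [:0, 1:]) = poly Q [:[:0, 1:]:] + poly Q [:0, 1:])"

definition additive_index :: "nat \<Rightarrow> 'a::zero poly \<Rightarrow> nat set" where
  "additive_index p P = {i. coeff P (p ^ i) \<noteq> 0}"

text \<open>For \<open>i\<close> in the index set and \<open>r = \<infinity>\<close> this is \<open>\<infinity>\<close>, because \<open>p > 0\<close> and the valuation of a
  nonzero coefficient is finite.\<close>

definition additive_line :: "nat \<Rightarrow> 'a::zero hahn poly \<Rightarrow> nat \<Rightarrow> ereal \<Rightarrow> ereal" where
  "additive_line p P i r = ereal (of_nat (p ^ i)) * r + hahn_val (coeff P (p ^ i))"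

definition minimal_lines :: "nat \<Rightarrow> 'a::zero hahn poly \<Rightarrow> ereal \<Rightarrow> nat set" where
  "minimal_lines p P r =
     {i \<in> additive_index p P.
        additive_line p P i r = (MIN j\<in>additive_index p P. additive_line p P j r)}"

definition intersection_point :: "nat \<Rightarrow> 'a::zero hahn poly \<Rightarrow> ereal \<Rightarrow> bool" where
  "intersection_point p P r \<longleftrightarrow> r \<noteq> -\<infinity> \<and> card (minimal_lines p P r) > 1"

section \<open>Expansion\<close>

definition minimal_coeff_field :: "'a::field hahn \<Rightarrow> 'a set" where
  "minimal_coeff_field x =
     \<Inter> {K. subfield K (ring_of_type_algebra :: 'a ring) \<and> x \<in> hahn_over K}"

definition expands :: "'a::field alg_closure \<Rightarrow> 'a hahn \<Rightarrow> rat \<Rightarrow> bool" where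
  "expands \<zeta> x r \<longleftrightarrow>
     hahn_trunc_le x r - hahn_trunc_less x r \<noteq> 0 \<and>
     hahn_to_ac (hahn_trunc_le x r - hahn_trunc_less x r) = hahn_monom \<zeta> r \<and>
     \<zeta> \<notin> to_ac ` minimal_coeff_field (hahn_trunc_less x r)"

end

theory Submission
  imports Defs "HOL-Algebra.Exponent"
begin

text \<open>
  Let \<open>y\<close> be the part of \<open>x\<close> with exponents below \<open>s\<close>, and let \<open>K\<close> be a subfield of the
  coefficient field containing the coefficients of \<open>y\<close>. The coefficients of \<open>P\<close> are series over the
  prime field, so \<open>P(y)\<close> has all its coefficients in \<open>K\<close>; by additivity the same holds for
  \<open>P(x - y) = - P(y)\<close>. The series \<open>x - y\<close> has no exponents below \<open>s\<close>, and at \<open>s\<close> it has the same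
  coefficient \<open>a\<close> as \<open>x\<close>. The coefficient of \<open>P(x - y)\<close> at the exponent \<open>min\<^sub>i \<gamma>\<^sub>i(s)\<close> therefore comes
  only from the lines that attain this minimum: it is the sum of the \<open>c\<^sub>i a^(p^i)\<close> over \<open>i \<in> J(s)\<close>,
  where \<open>c\<^sub>i\<close> is the leading coefficient of the coefficient of \<open>X^(p^i)\<close> in \<open>P\<close>. Hence this sum lies
  in \<open>K\<close> (\<open>lowest_lines_equation\<close>).

  The fact is used twice. With \<open>K\<close> the field of elements algebraic over the prime field, it says
  that the first coefficient of \<open>x\<close> outside \<open>K\<close> would be algebraic over \<open>K\<close>; as \<open>K\<close> is relatively
  algebraically closed, all coefficients of \<open>x\<close> are algebraic over the prime field
  (\<open>coeff_frobenius_periodic\<close>). Next take \<open>s = r\<close> and the minimal field \<open>K\<close> of the truncation. If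
  \<open>J(r)\<close> were a singleton \<open>{m}\<close>, then the \<open>p^m\<close>-th power of \<open>\<zeta>\<close> would lie in \<open>K\<close>. An element
  algebraic over the prime field is fixed by some power of Frobenius, so it is recovered from its
  \<open>p^m\<close>-th power by further applications of Frobenius
  (\<open>frobenius_periodic_root_in_subfield\<close>). Thus \<open>\<zeta>\<close> would lie in \<open>K\<close>, which the expansion
  hypothesis excludes.
\<close>

section \<open>Subfields of a field given as a type\<close>

abbreviation is_subfield :: "'a::field set \<Rightarrow> bool" where
  "is_subfield K \<equiv> subfield K (ring_of_type_algebra :: 'a ring)"

lemma is_subfield_iff:
  fixes K :: "'a::field set"
  shows "is_subfield K \<longleftrightarrow>
    1 \<in> K \<and> (\<forall>a\<in>K. - a \<in> K) \<and> (\<forall>a\<in>K. \<forall>b\<in>K. a + b \<in> K \<and> a * b \<in> K) \<and>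
    (\<forall>a\<in>K. inverse a \<in> K)" (is "_ \<longleftrightarrow> ?closed")
proof -
  interpret R: field "ring_of_type_algebra :: 'a ring" by (rule field_from_type_algebra)
  have uminus: "\<ominus>\<^bsub>(ring_of_type_algebra :: 'a ring)\<^esub> a = - a" for a :: 'a
    by (rule R.minus_equality) (simp_all add: ring_of_type_algebra_def)
  have inv: "inv\<^bsub>(ring_of_type_algebra :: 'a ring)\<^esub> a = inverse a" if "a \<noteq> 0" for a :: 'a
    using that by (intro R.comm_inv_char) (simp_all add: ring_of_type_algebra_def)
  note [simp] = ring_of_type_algebra_def
  show ?thesis
  proof
    assume K: "is_subfield K"
    have "inverse a \<in> K" if "a \<in> K" for a
    proof (cases "a = 0")
      case False
      then show ?thesis using R.subfield_m_inv(1)[OF K, of a] inv[of a] that by simp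
    qed (use that in simp)
    then show ?closed
      using subringE(3,5,6,7)[OF subfieldE(1)[OF K]] uminus by simp
  next
    assume closed: ?closed
    have "subring K (ring_of_type_algebra :: 'a ring)"
      using closed uminus by (intro R.subringI) simp_all
    then show "is_subfield K"
      using closed inv by (intro R.subfieldI') simp_all
  qed
qed

context
  fixes K :: "'a::field set"
  assumes K: "is_subfield K"
begin

lemma subfield_one: "1 \<in> K" and subfield_uminus: "a \<in> K \<Longrightarrow> - a \<in> K"
  and subfield_add: "a \<in> K \<Longrightarrow> b \<in> K \<Longrightarrow> a + b \<in> K"
  and subfield_mult: "a \<in> K \<Longrightarrow> b \<in> K \<Longrightarrow> a * b \<in> K"
  and subfield_inverse: "a \<in> K \<Longrightarrow> inverse a \<in> K"
  using K unfolding is_subfield_iff by blast+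

lemma subfield_zero: "0 \<in> K"
  using subfield_add[OF subfield_one subfield_uminus[OF subfield_one]] by simp

lemma subfield_sum: "(\<And>i. i \<in> I \<Longrightarrow> f i \<in> K) \<Longrightarrow> sum f I \<in> K"
  by (induction I rule: infinite_finite_induct) (auto intro: subfield_zero subfield_add)

lemma subfield_power: "a \<in> K \<Longrightarrow> a ^ n \<in> K"
  by (induction n) (auto intro: subfield_one subfield_mult)

lemma Ints_subset_subfield: "\<int> \<subseteq> K"
proof -
  have nat: "of_nat n \<in> K" for n :: nat
    by (induction n) (auto intro: subfield_zero subfield_one subfield_add)
  have "of_int z \<in> K" for z
    using nat[of "nat z"] subfield_uminus[OF nat[of "nat (- z)"]] by (cases "z \<ge> 0") auto
  then show ?thesis by (auto elim: Ints_cases)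
qed

end

lemma is_subfield_Inter:
  assumes "\<And>K. K \<in> \<K> \<Longrightarrow> is_subfield K"
  shows "is_subfield (\<Inter>\<K>)"
  using assms unfolding is_subfield_iff by simp

section \<open>Elements algebraic over the prime field\<close>

text \<open>In characteristic \<open>p > 0\<close> these are the elements algebraic over the prime field: each of them
  generates a finite field, on which Frobenius has finite order.\<close>

definition frobenius_periodic :: "'a::field set" where
  "frobenius_periodic = {z. \<exists>n>0. z ^ CHAR('a) ^ n = z}"

lemma frobenius_fixed_mult:
  fixes z :: "'a::comm_monoid_mult"
  assumes "z ^ p ^ n = z"
  shows "z ^ p ^ (n * k) = z"
  by (induction k) (use assms in \<open>simp_all add: power_add power_mult\<close>)

text \<open>The product of the individual periods is a common period.\<close>

lemma frobenius_periodic_common: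
  assumes "finite A" "A \<subseteq> (frobenius_periodic :: 'a::field set)"
  shows "\<exists>N>0. \<forall>a\<in>A. a ^ CHAR('a) ^ N = a"
proof -
  obtain n where n: "\<And>a. a \<in> A \<Longrightarrow> n a > 0 \<and> a ^ CHAR('a) ^ n a = a"
    using assms(2) unfolding frobenius_periodic_def subset_iff mem_Collect_eq by metis
  have "a ^ CHAR('a) ^ prod n A = a" if "a \<in> A" for a
    using n[OF that] frobenius_fixed_mult[of a "CHAR('a)" "n a"] prod.remove[OF assms(1) that, of n]
    by simp
  moreover have "prod n A > 0" using n by (intro prod_pos) auto
  ultimately show ?thesis by blast
qed

lemma is_subfield_frobenius_periodic:
  assumes "CHAR('a::field) > 0"
  shows "is_subfield (frobenius_periodic :: 'a set)"
proof -
  let ?p = "CHAR('a)"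
  have pr: "prime ?p" by (rule prime_CHAR_semidom[OF assms])
  have one: "(1::'a) \<in> frobenius_periodic"
    by (auto simp: frobenius_periodic_def intro: exI[of _ 1])
  have add_mult: "a + b \<in> frobenius_periodic \<and> a * b \<in> frobenius_periodic"
    if ab: "a \<in> frobenius_periodic" "b \<in> frobenius_periodic" for a b :: 'a
  proof -
    obtain N where "N > 0" "a ^ ?p ^ N = a" "b ^ ?p ^ N = b"
      using frobenius_periodic_common[of "{a, b}"] ab by auto
    then show ?thesis
      using freshmans_dream'[OF pr refl, of a b N]
      by (auto simp: frobenius_periodic_def power_mult_distrib intro!: exI[of _ N])
  qed
  have "- a \<in> frobenius_periodic" if a: "a \<in> frobenius_periodic" for a :: 'a
  proof -
    obtain N where N: "N > 0" "a ^ ?p ^ N = a" using a by (auto simp: frobenius_periodic_def)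
    have "0 = (a + (- a)) ^ ?p ^ N" using pr prime_gt_0_nat[OF pr] by (simp add: power_0_left)
    also have "\<dots> = a + (- a) ^ ?p ^ N" using freshmans_dream'[OF pr refl, of a "- a" N] N by simp
    finally have "(- a) ^ ?p ^ N = - a" by (metis add_eq_0_iff)
    then show ?thesis using N by (auto simp: frobenius_periodic_def)
  qed
  moreover have "inverse a \<in> frobenius_periodic" if "a \<in> frobenius_periodic" for a :: 'a
    using that by (auto simp: frobenius_periodic_def power_inverse)
  ultimately show ?thesis using one add_mult unfolding is_subfield_iff by blast
qed

lemma frobenius_power_cancel:
  fixes a b :: "'a::field"
  assumes "CHAR('a) > 0" "a ^ CHAR('a) ^ n = b ^ CHAR('a) ^ n"
  shows "a = b"
proof -
  have "prime CHAR('a)" by (rule prime_CHAR_semidom[OF assms(1)])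
  then have "(a - b) ^ CHAR('a) ^ n + b ^ CHAR('a) ^ n = b ^ CHAR('a) ^ n"
    using freshmans_dream'[of "CHAR('a) ^ n" n "a - b" b] assms(2) by simp
  then show ?thesis by simp
qed

text \<open>Let \<open>q\<close> be a power of \<open>p\<close> such that \<open>c\<^sup>q = c\<close> for all coefficients \<open>c\<close> of \<open>f\<close>. Then
  \<open>f(w\<^sup>q) = f(w)\<^sup>q\<close>, so the iterated \<open>q\<close>-th powers of a root \<open>z\<close> are roots as well. As \<open>f\<close> has
  finitely many roots, two of these powers agree, and injectivity of Frobenius makes \<open>z\<close> periodic.\<close>

lemma frobenius_periodic_algebraically_closed:
  fixes f :: "'a::field poly"
  assumes p: "CHAR('a) > 0"
    and f: "f \<noteq> 0" "\<And>i. coeff f i \<in> frobenius_periodic"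
    and z: "poly f z = 0"
  shows "z \<in> frobenius_periodic"
proof -
  let ?p = "CHAR('a)"
  have pr: "prime ?p" by (rule prime_CHAR_semidom[OF p])
  obtain N where N: "N > 0" "\<forall>a\<in>coeff f ` {..degree f}. a ^ ?p ^ N = a"
    using frobenius_periodic_common[of "coeff f ` {..degree f}"] f(2) by blast
  have conj: "poly f (w ^ ?p ^ N) = poly f w ^ ?p ^ N" for w
  proof -
    have "poly f w ^ ?p ^ N = (\<Sum>i\<le>degree f. (coeff f i * w ^ i) ^ ?p ^ N)"
      unfolding poly_altdef by (rule freshmans_dream_sum'[OF pr refl])
    also have "\<dots> = poly f (w ^ ?p ^ N)"
      unfolding poly_altdef
    proof (rule sum.cong)
      fix i assume "i \<in> {..degree f}"
      then have "coeff f i ^ ?p ^ N = coeff f i" using N(2) by blast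
      then show "(coeff f i * w ^ i) ^ ?p ^ N = coeff f i * (w ^ ?p ^ N) ^ i"
        by (simp add: power_mult_distrib flip: power_mult) (simp add: mult.commute)
    qed simp
    finally show ?thesis by simp
  qed
  have "poly f (z ^ ?p ^ (N * k)) = 0" for k
  proof (induction k)
    case (Suc k)
    have "z ^ ?p ^ (N * Suc k) = (z ^ ?p ^ (N * k)) ^ ?p ^ N"
      by (simp add: power_add mult.commute flip: power_mult)
    then show ?case using conj[of "z ^ ?p ^ (N * k)"] Suc p by (simp add: power_0_left)
  qed (use z in simp)
  then have "range (\<lambda>k. z ^ ?p ^ (N * k)) \<subseteq> {w. poly f w = 0}" by blast
  then have "finite (range (\<lambda>k. z ^ ?p ^ (N * k)))"
    using poly_roots_finite[OF f(1)] finite_subset by blast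
  then have "\<not> inj (\<lambda>k. z ^ ?p ^ (N * k))" using finite_imageD by fastforce
  then obtain i j where ij: "i < j" "z ^ ?p ^ (N * i) = z ^ ?p ^ (N * j)"
    by (auto simp: inj_on_def) (metis linorder_neqE_nat)
  have "N * j = N * (j - i) + N * i" using ij(1) by (simp add: algebra_simps)
  then have "z ^ ?p ^ (N * i) = (z ^ ?p ^ (N * (j - i))) ^ ?p ^ (N * i)"
    using ij(2) by (simp add: power_add power_mult)
  then have "z = z ^ ?p ^ (N * (j - i))" by (rule frobenius_power_cancel[OF p])
  then show ?thesis
    using N(1) ij(1) by (auto simp: frobenius_periodic_def intro!: exI[of _ "N * (j - i)"])
qed

text \<open>Subfields are in general not closed under \<open>p\<close>-th roots. A periodic \<open>z\<close>, however, is recovered from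
  its \<open>p^m\<close>-th power by applying Frobenius further, until a multiple of the period is reached.\<close>

lemma frobenius_periodic_root_in_subfield:
  assumes K: "is_subfield (K :: 'a::field set)"
    and z: "z \<in> frobenius_periodic" "z ^ CHAR('a) ^ m \<in> K"
  shows "z \<in> K"
proof -
  let ?p = "CHAR('a)"
  obtain n where n: "n > 0" "z ^ ?p ^ n = z" using z(1) by (auto simp: frobenius_periodic_def)
  have "n * m = m + (n * m - m)" using n(1) by simp
  then have "z = (z ^ ?p ^ m) ^ ?p ^ (n * m - m)"
    using frobenius_fixed_mult[OF n(2), of m] by (metis power_add power_mult)
  then show ?thesis using subfield_power[OF K z(2)] by metis
qed

section \<open>Exponents of additive polynomials\<close>

text \<open>This compares the coefficients of \<open>X\<^sup>n\<^sup>-\<^sup>k Y\<^sup>k\<close> in the identity \<open>P(X + Y) = P(X) + P(Y)\<close>: mixed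
  monomials do not occur on the right.\<close>

lemma additive_poly_binomial_eq_0:
  fixes P :: "'a::idom poly"
  assumes "additive_poly P" "0 < k" "k < n"
  shows "of_nat (n choose k) * coeff P n = 0"
proof -
  define C where "C = (\<lambda>c::'a. [:[:c:]:])"
  define Q where "Q = map_poly C P"
  have Q: "poly Q z = (\<Sum>i\<le>degree P. C (coeff P i) * z ^ i)" for z
  proof -
    have "coeff Q i = C (coeff P i)" for i
      unfolding Q_def by (rule coeff_map_poly) (simp add: C_def)
    moreover have "degree Q = degree P" unfolding Q_def by (rule degree_map_poly) (simp add: C_def)
    ultimately show ?thesis by (simp add: poly_altdef)
  qed
  have C: "coeff (coeff (C c * w) k) l = c * coeff (coeff w k) l" for c w k l
    by (simp add: C_def)
  have add: "poly Q [:[:0, 1:], 1:] = poly Q [:[:0, 1:]:] + poly Q [:0, 1:]"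
    using assms(1) by (simp add: additive_poly_def Let_def Q_def C_def)
  \<comment> \<open>\<open>[:[:0, 1:], 1:]\<close> is \<open>X + Y\<close>, read as a linear polynomial in \<open>Y\<close> over \<open>k[X]\<close>.\<close>
  have binom: "coeff (coeff ([:[:0, 1:], 1:] ^ i) k) (n - k) =
      (if i = n then of_nat (n choose k) else (0::'a))" for i
  proof (cases "k \<le> i")
    case True
    have "coeff ([:[:0, 1:], 1:] ^ i) k = of_nat (i choose k) * [:0, 1::'a:] ^ (i - k)"
      using coeff_linear_poly_power[OF True, of "[:0, 1::'a:]" 1] by simp
    also have "[:0, 1::'a:] ^ (i - k) = monom 1 (i - k)" by (simp add: monom_altdef)
    finally show ?thesis using True assms(3) by (auto simp: of_nat_poly)
  next
    case False
    have "degree ([:[:0, 1::'a:], 1:] ^ i) \<le> i" using degree_power_le[of "[:[:0, 1::'a:], 1:]" i] by simp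
    then show ?thesis using False assms(3) by (auto simp: coeff_eq_0)
  qed
  have "coeff (coeff (poly Q [:[:0, 1:], 1:]) k) (n - k) =
      (\<Sum>i\<le>degree P. if i = n then coeff P n * of_nat (n choose k) else 0)"
    unfolding Q coeff_sum C binom by (rule sum.cong) auto
  also have "\<dots> = coeff P n * of_nat (n choose k)"
    by (simp add: coeff_eq_0)
  finally have l: "coeff (coeff (poly Q [:[:0, 1:], 1:]) k) (n - k) = coeff P n * of_nat (n choose k)" .
  have "coeff (coeff ([:[:0, 1::'a:]:] ^ i) k) (n - k) = 0" for i
  proof -
    have "[:[:0, 1::'a:]:] ^ i = [:[:0, 1:] ^ i:]" by (simp add: poly_const_pow)
    then show ?thesis using assms(2) by (simp add: coeff_pCons split: nat.splits)
  qed
  then have r1: "coeff (coeff (poly Q [:[:0, 1:]:]) k) (n - k) = 0"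
    unfolding Q coeff_sum C by simp
  have "coeff (coeff ([:0, 1 :: 'a poly:] ^ i) k) (n - k) = 0" for i
  proof -
    have "[:0, 1 :: 'a poly:] ^ i = monom 1 i" by (simp add: monom_altdef)
    then show ?thesis using assms(3) by simp
  qed
  then have r2: "coeff (coeff (poly Q [:0, 1:]) k) (n - k) = 0"
    unfolding Q coeff_sum C by simp
  show ?thesis using arg_cong[OF add, of "\<lambda>w. coeff (coeff w k) (n - k)"] l r1 r2 by (simp add: mult.commute)
qed

lemma additive_poly_coeff_0:
  fixes P :: "'a::idom poly"
  assumes "additive_poly P"
  shows "coeff P 0 = 0"
proof -
  define Q where "Q = map_poly (\<lambda>c::'a. [:[:c:]:]) P"
  have Q: "coeff (coeff (poly Q w) 0) 0 = coeff P 0" if "coeff (coeff w 0) 0 = 0" for w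
  proof -
    have "poly (poly (poly Q w) 0) 0 = poly P (poly (poly w 0) 0)"
      unfolding Q_def by (induction P) (simp_all add: map_poly_pCons)
    then show ?thesis using that by (simp add: poly_0_coeff_0)
  qed
  have "poly Q ([:[:0, 1:]:] + [:0, 1:]) = poly Q [:[:0, 1:]:] + poly Q [:0, 1:]"
    using assms by (simp add: additive_poly_def Let_def Q_def)
  from arg_cong[OF this, of "\<lambda>w. coeff (coeff w 0) 0"]
  have "coeff P 0 = coeff P 0 + coeff P 0" by (simp only: coeff_add) (simp add: Q)
  then show ?thesis by (simp only: add_cancel_right_right)
qed

text \<open>If \<open>n = p^e m\<close> with \<open>m > 1\<close> prime to \<open>p\<close>, the binomial coefficient \<open>n choose p^e\<close> is prime to \<open>p\<close>,
  so a nonzero coefficient at \<open>n\<close> would contradict the preceding vanishing.\<close>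

lemma additive_poly_exponent:
  fixes P :: "'a::idom poly"
  assumes "CHAR('a) > 0" "additive_poly P" "coeff P n \<noteq> 0"
  obtains i where "n = CHAR('a) ^ i"
proof -
  let ?p = "CHAR('a)"
  have pr: "prime ?p" by (rule prime_CHAR_semidom[OF assms(1)])
  have n0: "n > 0" using additive_poly_coeff_0[OF assms(2)] assms(3) by (cases n) auto
  then obtain e m where n: "n = ?p ^ e * m" and m: "\<not> ?p dvd m"
    using multiplicity_decompose'[of n ?p] not_prime_unit pr by blast
  have "m = 1"
  proof (rule ccontr)
    assume "m \<noteq> 1"
    then have m1: "m > 1" using n0 n by (cases m) auto
    have k: "0 < ?p ^ e" "?p ^ e < n" using n m1 prime_gt_0_nat[OF pr] by auto
    have "of_nat (n choose ?p ^ e) = (0::'a)"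
      using additive_poly_binomial_eq_0[OF assms(2) k] assms(3) by simp
    then have "?p dvd n choose ?p ^ e" by (simp add: of_nat_eq_0_iff_char_dvd)
    moreover have "multiplicity ?p (n choose ?p ^ e) = 0"
      using const_p_fac[of m ?p e] m m1 pr by (simp add: n not_dvd_imp_multiplicity_0)
    moreover have "n choose ?p ^ e > 0" using k by simp
    ultimately show False
      using multiplicity_eq_zero_iff[of "n choose ?p ^ e" ?p] not_prime_unit pr by blast
  qed
  then show ?thesis using n that by simp
qed

section \<open>Coefficients of Hahn series\<close>

lemma CHAR_hahn: "CHAR('a::comm_ring_1 hahn) = CHAR('a)"
proof (rule CHAR_eqI)
  have coeff: "hahn_coeff (of_nat n :: 'a hahn) \<gamma> = (if \<gamma> = 0 then of_nat n else 0)" for n \<gamma>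
    by (induction n) (auto simp: hahn_coeff_one)
  show "of_nat CHAR('a) = (0 :: 'a hahn)" by (rule hahn_eqI) (simp add: coeff)
  show "CHAR('a) dvd n" if "of_nat n = (0 :: 'a hahn)" for n
  proof -
    have "(of_nat n :: 'a) = hahn_coeff (of_nat n) 0" by (simp only: coeff refl if_True)
    also have "\<dots> = 0" by (simp only: that hahn_coeff_zero)
    finally show ?thesis by (simp only: of_nat_eq_0_iff_char_dvd)
  qed
qed

text \<open>Well-ordered supports allow induction on exponents, used in the form of a least counterexample.\<close>

lemma first_coeff_outside:
  fixes x :: "'a::zero hahn"
  assumes "0 \<in> K" "hahn_coeff x \<gamma> \<notin> K"
  obtains s where "hahn_coeff x s \<notin> K" "\<And>\<beta>. \<beta> < s \<Longrightarrow> hahn_coeff x \<beta> \<in> K"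
proof -
  define B where "B = {\<beta>. hahn_coeff x \<beta> \<notin> K}"
  have "B \<subseteq> hahn_supp x" "B \<noteq> {}" using assms by (auto simp: B_def hahn_supp_def)
  then obtain s where s: "s \<in> B" "\<And>\<beta>. \<beta> \<in> B \<Longrightarrow> s \<le> \<beta>"
    using wfp_on_minE[OF wfp_on_hahn_supp] by metis
  show thesis
  proof (rule that)
    show "hahn_coeff x s \<notin> K" using s(1) by (simp add: B_def)
    show "hahn_coeff x \<beta> \<in> K" if "\<beta> < s" for \<beta> using s(2)[of \<beta>] that by (auto simp: B_def)
  qed
qed

text \<open>For nonzero \<open>x\<close> this is the valuation \<open>hahn_val x\<close> as a rational number.\<close>

definition hahn_order :: "'a::zero hahn \<Rightarrow> rat" where
  "hahn_order x = (LEAST \<gamma>. hahn_coeff x \<gamma> \<noteq> 0)"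

definition vanishes_below :: "rat \<Rightarrow> 'a::zero hahn \<Rightarrow> bool" where
  "vanishes_below s x \<longleftrightarrow> (\<forall>\<gamma><s. hahn_coeff x \<gamma> = 0)"

lemma hahn_order:
  assumes "x \<noteq> 0"
  shows "hahn_coeff x (hahn_order x) \<noteq> 0" "vanishes_below (hahn_order x) x"
proof -
  obtain \<gamma> where "hahn_coeff x \<gamma> \<notin> {0}" using assms hahn_eqI[of x 0] by auto
  then obtain m where m: "hahn_coeff x m \<noteq> 0" "\<And>\<beta>. \<beta> < m \<Longrightarrow> hahn_coeff x \<beta> = 0"
    using first_coeff_outside[of "{0}" x] by auto
  then have "hahn_order x = m"
    unfolding hahn_order_def by (intro Least_equality) (auto simp: not_less[symmetric])
  with m show "hahn_coeff x (hahn_order x) \<noteq> 0" "vanishes_below (hahn_order x) x"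
    by (simp_all add: vanishes_below_def)
qed

lemma hahn_val_nonzero: "x \<noteq> 0 \<Longrightarrow> hahn_val x = ereal (of_rat (hahn_order x))"
  by (simp add: hahn_val_def hahn_order_def)

lemma hahn_leading_mult:
  fixes x y :: "'a::comm_ring_1 hahn"
  assumes x: "vanishes_below s x" and y: "vanishes_below u y"
  shows "vanishes_below (s + u) (x * y)"
    and "hahn_coeff (x * y) (s + u) = hahn_coeff x s * hahn_coeff y u"
proof -
  have supp: "s \<le> \<alpha>" "u \<le> \<beta>" if "\<alpha> \<in> hahn_supp x" "\<beta> \<in> hahn_supp y" for \<alpha> \<beta>
    using that x y by (auto simp: hahn_supp_def vanishes_below_def not_less[symmetric])
  show "vanishes_below (s + u) (x * y)"
    unfolding vanishes_below_def
  proof (intro allI impI, rule ccontr)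
    fix \<gamma> assume "\<gamma> < s + u" "hahn_coeff (x * y) \<gamma> \<noteq> 0"
    then obtain a b where "\<gamma> = a + b" "a \<in> hahn_supp x" "b \<in> hahn_supp y"
      using hahn_supp_times[of x y] by (auto simp: hahn_supp_def)
    with supp[of a b] \<open>\<gamma> < s + u\<close> show False by simp
  qed
  have "{\<alpha>\<in>hahn_supp x. s + u - \<alpha> \<in> hahn_supp y} \<subseteq> {s}"
  proof
    fix \<alpha> assume "\<alpha> \<in> {\<alpha>\<in>hahn_supp x. s + u - \<alpha> \<in> hahn_supp y}"
    then show "\<alpha> \<in> {s}" using supp[of \<alpha> "s + u - \<alpha>"] by auto
  qed
  then have "hahn_coeff (x * y) (s + u) = (\<Sum>\<alpha>\<in>{s}. hahn_coeff x \<alpha> * hahn_coeff y (s + u - \<alpha>))"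
    by (intro hahn_coeff_times_superset) auto
  then show "hahn_coeff (x * y) (s + u) = hahn_coeff x s * hahn_coeff y u" by simp
qed

lemma hahn_leading_power:
  fixes x :: "'a::comm_ring_1 hahn"
  assumes "vanishes_below s x"
  shows "vanishes_below (of_nat n * s) (x ^ n) \<and>
    hahn_coeff (x ^ n) (of_nat n * s) = hahn_coeff x s ^ n"
proof (induction n)
  case 0
  then show ?case by (simp add: vanishes_below_def hahn_coeff_one)
next
  case (Suc n)
  then show ?case
    using hahn_leading_mult[OF assms, of "of_nat n * s" "x ^ n"] by (simp add: algebra_simps)
qed

text \<open>Suppose \<open>\<beta>\<close> is the first exponent at which \<open>y = 1/x\<close> has a coefficient outside \<open>K\<close>, and let
  \<open>m\<close> be the order of \<open>x\<close>. In the coefficient of \<open>x y = 1\<close> at \<open>m + \<beta>\<close> every term other than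
  \<open>x\<^sub>m y\<^sub>\<beta>\<close> involves only earlier coefficients of \<open>y\<close>, so \<open>y\<^sub>\<beta>\<close> can be solved for within \<open>K\<close>.\<close>

lemma hahn_over_inverse:
  assumes K: "is_subfield (K :: 'a::field set)" and x: "x \<in> hahn_over K"
  shows "inverse x \<in> hahn_over K"
proof (cases "x = 0")
  case False
  define y where "y = inverse x"
  define m where "m = hahn_order x"
  have lead: "hahn_coeff x m \<noteq> 0" and below: "vanishes_below m x"
    using hahn_order[OF False] by (simp_all add: m_def)
  have "hahn_coeff y \<gamma> \<in> K" for \<gamma>
  proof (rule ccontr)
    assume "hahn_coeff y \<gamma> \<notin> K"
    then obtain \<beta> where \<beta>: "hahn_coeff y \<beta> \<notin> K" "\<And>\<alpha>. \<alpha> < \<beta> \<Longrightarrow> hahn_coeff y \<alpha> \<in> K"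
      using first_coeff_outside[OF subfield_zero[OF K], of y] by metis
    define S where "S = {\<alpha>\<in>hahn_supp x. m + \<beta> - \<alpha> \<in> hahn_supp y}"
    have fin: "finite S" unfolding S_def by (intro finite_antidiagonal wfp_on_hahn_supp)
    have m: "m \<in> S" using lead \<beta>(1) subfield_zero[OF K] by (auto simp: S_def hahn_supp_def)
    have "hahn_coeff (x * y) (m + \<beta>) \<in> K"
      using hahn_coeff_one[of "m + \<beta>", where ?'a = 'a] False subfield_zero[OF K] subfield_one[OF K]
      by (simp add: y_def)
    also have "hahn_coeff (x * y) (m + \<beta>) = hahn_coeff x m * hahn_coeff y \<beta> +
        (\<Sum>\<alpha>\<in>S - {m}. hahn_coeff x \<alpha> * hahn_coeff y (m + \<beta> - \<alpha>))"
      unfolding hahn_coeff_times S_def[symmetric] by (subst sum.remove[OF fin m]) simp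
    finally have total: "\<dots> \<in> K" .
    have rest: "(\<Sum>\<alpha>\<in>S - {m}. hahn_coeff x \<alpha> * hahn_coeff y (m + \<beta> - \<alpha>)) \<in> K"
    proof (intro subfield_sum[OF K] subfield_mult[OF K])
      fix \<alpha> assume "\<alpha> \<in> S - {m}"
      then have "m < \<alpha>" using below by (force simp: S_def hahn_supp_def vanishes_below_def)
      then show "hahn_coeff y (m + \<beta> - \<alpha>) \<in> K" by (intro \<beta>(2)) simp
      show "hahn_coeff x \<alpha> \<in> K" using x by (simp add: hahn_over_def)
    qed
    have "hahn_coeff x m * hahn_coeff y \<beta> \<in> K"
      using subfield_add[OF K total subfield_uminus[OF K rest]] by simp
    moreover have "inverse (hahn_coeff x m) \<in> K"
      using x by (intro subfield_inverse[OF K]) (simp add: hahn_over_def)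
    ultimately have "inverse (hahn_coeff x m) * (hahn_coeff x m * hahn_coeff y \<beta>) \<in> K"
      by (metis subfield_mult[OF K])
    then show False using \<beta>(1) lead by (simp add: mult.assoc[symmetric])
  qed
  then show ?thesis by (auto simp: hahn_over_def y_def)
qed (use x in simp)

lemma is_subfield_hahn_over:
  assumes K: "is_subfield (K :: 'a::field set)"
  shows "is_subfield (hahn_over K)"
proof -
  have "x * y \<in> hahn_over K" if "x \<in> hahn_over K" "y \<in> hahn_over K" for x y
    using that by (simp add: hahn_over_def hahn_coeff_times subfield_sum[OF K] subfield_mult[OF K])
  then show ?thesis
    unfolding is_subfield_iff using hahn_over_inverse[OF K]
    by (auto simp: hahn_over_def hahn_coeff_one
        intro: subfield_zero[OF K] subfield_one[OF K] subfield_uminus[OF K] subfield_add[OF K])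
qed

text \<open>As \<open>K((t^\<rat>))\<close> is a field, it contains \<open>t\<close> and the integers, hence all rational functions
  in \<open>t\<close> over the prime field.\<close>

lemma prime_rational_functions_subset:
  assumes K: "is_subfield (K :: 'a::field set)"
  shows "prime_rational_functions \<subseteq> hahn_over K"
proof
  note H = is_subfield_hahn_over[OF K]
  fix x :: "'a hahn" assume "x \<in> prime_rational_functions"
  then obtain f g where x: "x = poly f (hahn_monom 1 1) / poly g (hahn_monom 1 1)"
    and fg: "\<forall>i. coeff f i \<in> \<int>" "\<forall>i. coeff g i \<in> \<int>"
    unfolding prime_rational_functions_def by blast
  have "hahn_monom 1 1 \<in> hahn_over K"
    using subfield_zero[OF K] subfield_one[OF K] by (simp add: hahn_over_def hahn_coeff_monom)
  then have "poly h (hahn_monom 1 1) \<in> hahn_over K" if "\<forall>i. coeff h i \<in> \<int>" for h :: "'a hahn poly"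
    using that Ints_subset_subfield[OF H] unfolding poly_altdef
    by (intro subfield_sum[OF H] subfield_mult[OF H] subfield_power[OF H]) auto
  then show "x \<in> hahn_over K"
    using fg unfolding x divide_hahn_def by (intro subfield_mult[OF H] subfield_inverse[OF H]) auto
qed

section \<open>Roots of additive polynomials\<close>

text \<open>Rational counterparts of \<open>additive_line\<close> and \<open>minimal_lines\<close>, so that the values of the lines can
  serve as exponents of series.\<close>

definition line_value :: "nat \<Rightarrow> 'a::zero hahn poly \<Rightarrow> nat \<Rightarrow> rat \<Rightarrow> rat" where
  "line_value p P i s = of_nat (p ^ i) * s + hahn_order (coeff P (p ^ i))"

definition lowest_lines :: "nat \<Rightarrow> 'a::zero hahn poly \<Rightarrow> rat \<Rightarrow> nat set" where
  "lowest_lines p P s = {i \<in> additive_index p P. \<forall>j\<in>additive_index p P.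
     line_value p P i s \<le> line_value p P j s}"

definition leading_coeff :: "'a::zero hahn \<Rightarrow> 'a" where
  "leading_coeff x = hahn_coeff x (hahn_order x)"

lemma finite_additive_index:
  assumes "p > 1"
  shows "finite (additive_index p P)"
proof -
  have "(\<lambda>i. p ^ i) ` additive_index p P \<subseteq> {..degree P}"
    by (auto simp: additive_index_def le_degree)
  moreover have "inj_on (\<lambda>i. p ^ i) (additive_index p P)"
    using assms by (auto simp: inj_on_def)
  ultimately show ?thesis using finite_subset finite_imageD by blast
qed

lemma lowest_lines_nonempty:
  assumes "p > 1" "additive_index p P \<noteq> {}"
  shows "lowest_lines p P s \<noteq> {}"
proof -
  note fin = finite_additive_index[OF assms(1), of P]
  have "Min ((\<lambda>i. line_value p P i s) ` additive_index p P) \<in>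
      (\<lambda>i. line_value p P i s) ` additive_index p P"
    using fin assms(2) by (intro Min_in) auto
  then obtain i where "i \<in> additive_index p P"
    "line_value p P i s = Min ((\<lambda>i. line_value p P i s) ` additive_index p P)"
    by auto
  then have "i \<in> lowest_lines p P s" using fin by (simp add: lowest_lines_def)
  then show ?thesis by blast
qed

lemma minimal_lines_eq_lowest_lines:
  assumes "p > 1"
  shows "minimal_lines p P (ereal (of_rat s)) = lowest_lines p P s"
proof -
  let ?I = "additive_index p P"
  have line: "additive_line p P i (ereal (of_rat s)) = ereal (of_rat (line_value p P i s))"
    if "i \<in> ?I" for i
    using that
    by (simp add: additive_line_def additive_index_def hahn_val_nonzero line_value_def
        of_rat_add of_rat_mult of_rat_power)
  have "additive_line p P i (ereal (of_rat s)) = (MIN j\<in>?I. additive_line p P j (ereal (of_rat s)))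
      \<longleftrightarrow> (\<forall>j\<in>?I. line_value p P i s \<le> line_value p P j s)" if i: "i \<in> ?I" for i
  proof -
    have "additive_line p P i (ereal (of_rat s)) = (MIN j\<in>?I. additive_line p P j (ereal (of_rat s)))
      \<longleftrightarrow> (\<forall>j\<in>?I. additive_line p P i (ereal (of_rat s)) \<le> additive_line p P j (ereal (of_rat s)))"
      using finite_additive_index[OF assms, of P] i by (subst eq_commute, subst Min_eq_iff) auto
    then show ?thesis using i by (simp add: line of_rat_less_eq)
  qed
  then show ?thesis unfolding minimal_lines_def lowest_lines_def by blast
qed

lemma additive_poly_eval:
  fixes P :: "'a::idom poly"
  assumes "CHAR('a) = p" "p > 0" "additive_poly P"
  shows "poly P x = (\<Sum>i\<in>additive_index p P. coeff P (p ^ i) * x ^ p ^ i)"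
proof -
  have p1: "p > 1" using prime_CHAR_semidom[where ?'a = 'a] assms prime_gt_1_nat by metis
  have exp: "\<exists>i. n = p ^ i" if "coeff P n \<noteq> 0" for n
    using additive_poly_exponent[of P n] assms that by metis
  have "poly P x = (\<Sum>n\<in>(\<lambda>i. p ^ i) ` additive_index p P. coeff P n * x ^ n)"
    unfolding poly_altdef
    by (rule sum.mono_neutral_right) (use exp in \<open>force simp: additive_index_def le_degree\<close>)+
  also have "\<dots> = (\<Sum>i\<in>additive_index p P. coeff P (p ^ i) * x ^ p ^ i)"
    using p1 by (subst sum.reindex) (auto simp: inj_on_def)
  finally show ?thesis .
qed

lemma additive_poly_add:
  fixes P :: "'a::idom poly"
  assumes "CHAR('a) > 0" "additive_poly P"
  shows "poly P (x + y) = poly P x + poly P y"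
  unfolding additive_poly_eval[OF refl assms]
  by (simp add: freshmans_dream'[OF prime_CHAR_semidom[OF assms(1)] refl] algebra_simps sum.distrib)

text \<open>Each summand \<open>a\<^sub>i z^(p^i)\<close> starts no earlier than its own line \<open>\<gamma>\<^sub>i(s)\<close>, so only the lines through
  the minimum contribute, each with the product of the leading coefficients.\<close>

lemma coeff_at_lowest_lines:
  fixes P :: "'a::field hahn poly"
  assumes fin: "finite (additive_index p P)" and z: "vanishes_below s z"
    and m: "m \<in> lowest_lines p P s"
  shows "hahn_coeff (\<Sum>i\<in>additive_index p P. coeff P (p ^ i) * z ^ p ^ i) (line_value p P m s) =
    (\<Sum>i\<in>lowest_lines p P s. leading_coeff (coeff P (p ^ i)) * hahn_coeff z s ^ p ^ i)"
proof -
  let ?\<mu> = "line_value p P m s" and ?I = "additive_index p P"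
  have summand: "hahn_coeff (coeff P (p ^ i) * z ^ p ^ i) ?\<mu> =
      (if i \<in> lowest_lines p P s then leading_coeff (coeff P (p ^ i)) * hahn_coeff z s ^ p ^ i else 0)"
    if i: "i \<in> ?I" for i
  proof -
    have nz: "coeff P (p ^ i) \<noteq> 0" using i by (simp add: additive_index_def)
    have pow: "vanishes_below (of_nat (p ^ i) * s) (z ^ p ^ i)"
      "hahn_coeff (z ^ p ^ i) (of_nat (p ^ i) * s) = hahn_coeff z s ^ p ^ i"
      using hahn_leading_power[OF z, of "p ^ i"] by blast+
    note lead = hahn_leading_mult[OF hahn_order(2)[OF nz] pow(1)]
    have val: "hahn_order (coeff P (p ^ i)) + of_nat (p ^ i) * s = line_value p P i s"
      by (simp add: line_value_def)
    have le: "?\<mu> \<le> line_value p P i s" using m i by (simp add: lowest_lines_def)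
    show ?thesis
    proof (cases "i \<in> lowest_lines p P s")
      case True
      then have "?\<mu> = line_value p P i s" using le m by (auto simp: lowest_lines_def intro: antisym)
      then show ?thesis using True lead(2) pow(2) by (simp only: val leading_coeff_def if_True)
    next
      case False
      then have "?\<mu> < line_value p P i s" using le m i by (force simp: lowest_lines_def)
      then show ?thesis using False lead(1) by (simp only: val vanishes_below_def if_False)
    qed
  qed
  have "hahn_coeff (\<Sum>i\<in>?I. coeff P (p ^ i) * z ^ p ^ i) ?\<mu> =
      (\<Sum>i\<in>?I. if i \<in> lowest_lines p P s then leading_coeff (coeff P (p ^ i)) * hahn_coeff z s ^ p ^ i else 0)"
    unfolding hahn_coeff_sum using summand by (intro sum.cong) auto
  also have "\<dots> = (\<Sum>i\<in>lowest_lines p P s. leading_coeff (coeff P (p ^ i)) * hahn_coeff z s ^ p ^ i)"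
    using fin by (intro sum.mono_neutral_cong_right) (auto simp: lowest_lines_def)
  finally show ?thesis .
qed

locale additive_root =
  fixes p :: nat and P :: "'a::field hahn poly" and x :: "'a hahn"
  assumes CHAR: "CHAR('a) = p" and pos: "p > 0"
    and coeffs: "\<And>i. coeff P i \<in> prime_rational_functions"
    and nonzero: "P \<noteq> 0" and additive: "additive_poly P" and root: "poly P x = 0"
begin

lemma CHAR_hahn_eq: "CHAR('a hahn) = p"
  using CHAR by (simp add: CHAR_hahn)

lemma p_gt_1: "p > 1"
  using prime_CHAR_semidom[where ?'a = 'a] CHAR pos prime_gt_1_nat by metis

lemma additive_index_nonempty: "additive_index p P \<noteq> {}"
proof -
  have "coeff P (degree P) \<noteq> 0" using nonzero by simp
  then obtain i where "degree P = p ^ i"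
    using additive_poly_exponent[of P] additive CHAR_hahn_eq pos by metis
  then show ?thesis using nonzero by (auto simp: additive_index_def) (metis leading_coeff_0_iff)
qed

lemma leading_coeff_in_subfield: "is_subfield K \<Longrightarrow> leading_coeff (coeff P n) \<in> K"
  using prime_rational_functions_subset[of K] coeffs[of n]
  by (auto simp: leading_coeff_def hahn_over_def)

text \<open>The sum is the coefficient of \<open>P(x - y) = - P(y)\<close> at the minimal line value, where
  \<open>y\<close> is the truncation; and \<open>P(y)\<close> has coefficients in \<open>K\<close>.\<close>

lemma lowest_lines_equation:
  assumes K: "is_subfield K" and trunc: "hahn_trunc_less x s \<in> hahn_over K"
  shows "(\<Sum>i\<in>lowest_lines p P s. leading_coeff (coeff P (p ^ i)) * hahn_coeff x s ^ p ^ i) \<in> K"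
proof -
  note H = is_subfield_hahn_over[OF K]
  define y where "y = hahn_trunc_less x s"
  define z where "z = x - y"
  obtain m where m: "m \<in> lowest_lines p P s"
    using lowest_lines_nonempty[OF p_gt_1 additive_index_nonempty] by blast
  have z: "vanishes_below s z" "hahn_coeff z s = hahn_coeff x s"
    by (simp_all add: vanishes_below_def z_def y_def hahn_trunc_less.rep_eq)
  have "poly P y + poly P z = 0"
    using additive_poly_add[of P y z] additive root CHAR_hahn_eq pos by (simp add: z_def)
  moreover have "poly P y \<in> hahn_over K"
    using prime_rational_functions_subset[OF K] coeffs trunc unfolding poly_altdef y_def
    by (intro subfield_sum[OF H] subfield_mult[OF H] subfield_power[OF H]) auto
  ultimately have "poly P z \<in> hahn_over K"
    using subfield_uminus[OF H, of "poly P y"] by (metis add_eq_0_iff)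
  then have "hahn_coeff (poly P z) (line_value p P m s) \<in> K" by (simp add: hahn_over_def)
  then show ?thesis
    using coeff_at_lowest_lines[OF finite_additive_index[OF p_gt_1] z(1) m]
    by (simp add: additive_poly_eval[OF CHAR_hahn_eq pos additive] z(2))
qed

text \<open>At the first coefficient \<open>a\<close> of \<open>x\<close> that is not algebraic over the prime field, the preceding relation
  is a polynomial equation for \<open>a\<close> over the algebraic elements. It is nontrivial because the
  exponents \<open>p^i\<close> are distinct and positive and the leading coefficients are nonzero, so \<open>a\<close> would be
  algebraic after all.\<close>

lemma coeff_frobenius_periodic: "hahn_coeff x \<gamma> \<in> frobenius_periodic"
proof (rule ccontr)
  let ?k = "frobenius_periodic :: 'a set"
  assume "hahn_coeff x \<gamma> \<notin> ?k"
  have p: "CHAR('a) > 0" using CHAR pos by simp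
  note k = is_subfield_frobenius_periodic[OF p]
  obtain s where s: "hahn_coeff x s \<notin> ?k" "\<And>\<gamma>. \<gamma> < s \<Longrightarrow> hahn_coeff x \<gamma> \<in> ?k"
    using first_coeff_outside[OF subfield_zero[OF k] \<open>hahn_coeff x \<gamma> \<notin> ?k\<close>] by metis
  have "hahn_trunc_less x s \<in> hahn_over ?k"
    using s(2) subfield_zero[OF k] by (simp add: hahn_over_def hahn_trunc_less.rep_eq)
  note eq = lowest_lines_equation[OF k this]
  define c where "c = (\<lambda>i. leading_coeff (coeff P (p ^ i)))"
  define b where "b = (\<Sum>i\<in>lowest_lines p P s. c i * hahn_coeff x s ^ p ^ i)"
  define f where "f = (\<Sum>i\<in>lowest_lines p P s. monom (c i) (p ^ i)) - [:b:]"
  have fin: "finite (lowest_lines p P s)"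
    using finite_additive_index[OF p_gt_1, of P] by (auto simp: lowest_lines_def)
  have ck: "c i \<in> ?k" for i unfolding c_def by (rule leading_coeff_in_subfield[OF k])
  have "b \<in> ?k" using eq by (simp add: b_def c_def)
  have "poly f (hahn_coeff x s) = 0" by (simp add: f_def b_def poly_sum poly_monom)
  moreover have "coeff f n \<in> ?k" for n
  proof -
    have "coeff f n = (\<Sum>i\<in>lowest_lines p P s. if p ^ i = n then c i else 0) +
        - (if n = 0 then b else 0)"
      by (simp add: f_def coeff_sum coeff_pCons split: nat.splits)
    also have "\<dots> \<in> ?k"
      using ck \<open>b \<in> ?k\<close> subfield_zero[OF k]
      by (intro subfield_add[OF k] subfield_sum[OF k] subfield_uminus[OF k]) auto
    finally show ?thesis .
  qed
  moreover have "f \<noteq> 0"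
  proof -
    obtain m where m: "m \<in> lowest_lines p P s"
      using lowest_lines_nonempty[OF p_gt_1 additive_index_nonempty] by blast
    have "coeff f (p ^ m) = (\<Sum>i\<in>lowest_lines p P s. if i = m then c i else 0)"
      using p_gt_1 by (auto simp: f_def coeff_sum coeff_pCons split: nat.splits intro!: sum.cong)
    also have "\<dots> = c m" using fin m by simp
    also have "c m \<noteq> 0"
      using m hahn_order(1)[of "coeff P (p ^ m)"]
      by (simp add: c_def leading_coeff_def lowest_lines_def additive_index_def)
    finally show ?thesis by auto
  qed
  ultimately show False using frobenius_periodic_algebraically_closed[OF p] s(1) by blast
qed

end

theorem theorem5p6:
  fixes p :: nat
    and P :: "'a::field hahn poly"
    and \<zeta> :: "'a alg_closure"
    and x :: "'a hahn"
    and r :: rat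
  assumes "CHAR('a) = p" and "p > 0"
    and "perfect_field TYPE('a)"
    and "\<forall>i. coeff P i \<in> prime_rational_functions"
    and "P \<noteq> 0"
    and "additive_poly P"
    and "poly P x = 0"
    and "expands \<zeta> x r"
  shows "intersection_point p P (ereal (of_rat r))"
proof (rule ccontr)
  assume not: "\<not> intersection_point p P (ereal (of_rat r))"
  interpret additive_root p P x by standard (use assms in auto)
  define K where "K = minimal_coeff_field (hahn_trunc_less x r)"
  define a where "a = hahn_coeff x r"
  have K: "is_subfield K"
    unfolding K_def minimal_coeff_field_def by (rule is_subfield_Inter) blast
  have trunc: "hahn_trunc_less x r \<in> hahn_over K"
    by (auto simp: K_def minimal_coeff_field_def hahn_over_def)
  have "hahn_to_ac (hahn_trunc_le x r - hahn_trunc_less x r) = hahn_monom \<zeta> r"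
    using assms(8) by (simp add: expands_def)
  from arg_cong[OF this, of "\<lambda>w. hahn_coeff w r"] have "\<zeta> = to_ac a"
    by (simp add: a_def hahn_to_ac.rep_eq hahn_trunc_le.rep_eq hahn_trunc_less.rep_eq hahn_coeff_monom)
  then have notin: "a \<notin> K" using assms(8) by (auto simp: expands_def K_def)
  have "card (lowest_lines p P r) \<le> 1"
    using not by (simp add: intersection_point_def minimal_lines_eq_lowest_lines[OF p_gt_1])
  moreover have "finite (lowest_lines p P r)"
    using finite_additive_index[OF p_gt_1, of P] by (auto simp: lowest_lines_def)
  moreover have "lowest_lines p P r \<noteq> {}"
    by (rule lowest_lines_nonempty[OF p_gt_1 additive_index_nonempty])
  ultimately have "card (lowest_lines p P r) = 1" by (simp add: card_gt_0_iff le_antisym Suc_leI)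
  then obtain m where m: "lowest_lines p P r = {m}" by (rule card_1_singletonE)
  define c where "c = leading_coeff (coeff P (p ^ m))"
  have "c \<noteq> 0"
    using m hahn_order(1)[of "coeff P (p ^ m)"]
    by (auto simp: c_def leading_coeff_def lowest_lines_def additive_index_def)
  have "c * a ^ p ^ m \<in> K"
    using lowest_lines_equation[OF K trunc] by (simp add: m c_def a_def)
  moreover have "inverse c \<in> K"
    unfolding c_def by (intro subfield_inverse[OF K] leading_coeff_in_subfield[OF K])
  ultimately have "inverse c * (c * a ^ p ^ m) \<in> K" by (metis subfield_mult[OF K])
  moreover have "inverse c * (c * a ^ p ^ m) = a ^ p ^ m" using \<open>c \<noteq> 0\<close> by simp
  ultimately have "a ^ CHAR('a) ^ m \<in> K" using CHAR by metis
  then have "a \<in> K"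
    using frobenius_periodic_root_in_subfield[OF K] coeff_frobenius_periodic by (simp add: a_def)
  with notin show False ..
qed

end
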